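(* For any $\delta\in(0,1)$ and any $u\in\mathscr{U}$, $$\rho_{u,\delta}(X)=\mathbb{E}_{\mathbb{P}_X}[u(X)]+F_\varepsilon^{-1}(\delta)\qquad\text{for all }X\in\mathcal{L}^p(\Omega,\mathcal{F},\mathbb{P};[0,\bar b]).$$ Moreover, for any $\delta\in(0,1)$, the following two problems share the same set of optimal solutions: $$\max_{x\in\mathcal{X}}\ \rho_{\hat u_{\rm MLE},\delta}\big(x^\top(\mathbf{1}+\xi)\big)\qquad\text{and}\qquad\max_{x\in\mathcal{X}}\ \mathbb{E}_{\mathbb{P}_\xi}\big[\hat u_{\rm MLE}(x^\top(\mathbf{1}+\xi))\big].$$
   Context: Fix $\bar b>0$, $L>0$, $\bar c>0$ and a probability space $(\Omega,\mathcal{F},\mathbb{P})$. $\mathcal{L}^p(\Omega,\mathcal{F},\mathbb{P};[0,\bar b])$ is the set of $[0,\bar b]$-valued random variables (with finite $p$-th moment). $\mathscr{U}$ is the set of integrable functions $u:[0,\bar b]\to[0,1]$. The response error $\varepsilon$ is $\mathrm{Gumbel}(0,\sigma)$ distributed, $\sigma>0$, with CDF $F_\varepsilon(x)=e^{-e^{-x/\sigma}}$, independent of the lotteries. The Preference-at-Risk measure is $$\rho_{u,\delta}(X):=\max\{\eta\in\mathbb{R}:\ \mathbb{P}_\varepsilon(\mathbb{E}_{\mathbb{P}_X}[u(X)]+\varepsilon\ge\eta)\ge1-\delta\}.$$ Portfolios: $\xi=(\xi_0,\xi_1,\dots,\xi_S)^\top$ is a random vector of return rates with $\xi_0=0$;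 $\mathcal{X}=\{x\in\mathbb{R}^{S+1}:\sum_{s=0}^Sx_s=W_0,\ 0\le x_0\le W_0,\ 0\le x_s\le c_sW_0,\ s=1,\dots,S\}$ with $W_0\in[0,\bar b]$, $c_s\in[0,1]$; the wealth $x^\top(\mathbf{1}+\xi)$ is assumed to take values in $[0,\bar b]$ for all $x\in\mathcal{X}$ ($\mathbf{1}$ the all-ones vector). MLE-based utility $\hat u_{\rm MLE}$: given data $(W_k,Y_k,Z_k)$, $k=1,\dots,K$, with $W_k,Y_k$ lotteries with finite support in $[0,\bar b]$ and $Z_k\in\{1,-1\}$, let $\{y_1<\dots<y_N\}$ be the ordered union of $\{0,\bar b\}$ and all the supports, and $p^k_j=\mathbb{P}[W_k=y_j]-\mathbb{P}[Y_k=y_j]$. Let $(\bar\alpha^*,\bar\beta^*,\gamma^* )$ maximize $-\sum_{k}\log\big[1+\exp\big(\sum_{j=1}^N -Z_kp^k_j\bar\alpha_j\big)\big]$ over $\bar\alpha\in\mathbb{R}^N$, $\bar\beta\in\mathbb{R}^{N-1}$, $\gamma\in[0,\bar c]$ subject to $\bar\beta_j=(\bar\alpha_{j+1}-\bar\alpha_j)/(y_{j+1}-y_j)$, $\bar\beta_{j+1}\le\bar\beta_j$, $\bar\beta_1\le L\gamma$, $\bar\beta_{N-1}\ge0$, $\bar\alpha_1=0$, $\bar\alpha_N=\gamma$; assume $\gamma^*>0$ (needed for $\hat u_{\rm MLE}$ to be defined). Then $\hat u_{\rm MLE}:[0,\bar b]\to[0,1]$ is the continuous function that is affine on each $[y_j,y_{j+1}]$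 with $\hat u_{\rm MLE}(y_j)=\bar\alpha^*_j/\gamma^*$. *)

theory Defs
  imports "HOL-Probability.Probability"
begin

definition Lp_interval :: "'a measure \<Rightarrow> real \<Rightarrow> real \<Rightarrow> ('a \<Rightarrow> real) set" where
  "Lp_interval M p b =
     {X \<in> borel_measurable M. (\<forall>\<omega>\<in>space M. X \<omega> \<in> {0..b}) \<and> integrable M (\<lambda>\<omega>. \<bar>X \<omega>\<bar> powr p)}"

text \<open>Values of a utility outside \<open>[0, b]\<close> are unconstrained and never used.
  Integrability is with respect to the completed Lebesgue measure. For a utility that is not
  Borel, \<open>u \<circ> X\<close> may fail to be measurable; its Bochner integral is then 0 by convention.\<close>

definition utilities :: "real \<Rightarrow> (real \<Rightarrow> real) set" where
  "utilities b = {u \<in> {0..b} \<rightarrow> {0..1}. set_integrable lebesgue {0..b} u}"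

definition gumbel_cdf :: "real \<Rightarrow> real \<Rightarrow> real" where
  "gumbel_cdf \<sigma> x = exp (- exp (- x / \<sigma>))"

definition gumbel_distributed :: "'e measure \<Rightarrow> real \<Rightarrow> ('e \<Rightarrow> real) \<Rightarrow> bool" where
  "gumbel_distributed N \<sigma> \<epsilon> \<longleftrightarrow>
     \<epsilon> \<in> borel_measurable N \<and> cdf (distr N borel \<epsilon>) = gumbel_cdf \<sigma>"

text \<open>The response error \<open>\<epsilon>\<close> lives on a probability space \<open>N\<close> separate from the space \<open>M\<close> of
  the lotteries (its independence of them is that of the coordinates of the product of \<open>M\<close> and
  \<open>N\<close>), so the outer probability only averages over \<open>\<epsilon>\<close>. \<open>GREATEST\<close> is the attained maximum.\<close>

definition pref_at_risk ::
    "'a measure \<Rightarrow> 'e measure \<Rightarrow> ('e \<Rightarrow> real) \<Rightarrow> (real \<Rightarrow> real) \<Rightarrow> real \<Rightarrow> ('a \<Rightarrow> real) \<Rightarrow> real" where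
  "pref_at_risk M N \<epsilon> u \<delta> X =
     (GREATEST \<eta>. measure N {e \<in> space N. (\<integral>\<omega>. u (X \<omega>) \<partial>M) + \<epsilon> e \<ge> \<eta>} \<ge> 1 - \<delta>)"

text \<open>Assets are indexed by a finite type \<open>'n\<close> with \<open>S + 1\<close> elements; \<open>r\<close> is the riskless asset,
  which has index 0 in the usual numbering. The value \<open>c r\<close> is irrelevant.\<close>

definition portfolios :: "'n::finite \<Rightarrow> real \<Rightarrow> ('n \<Rightarrow> real) \<Rightarrow> (real ^ 'n) set" where
  "portfolios r W0 c =
     {x. (\<Sum>s\<in>UNIV. x $ s) = W0 \<and> 0 \<le> x $ r \<and> x $ r \<le> W0 \<and>
         (\<forall>s. s \<noteq> r \<longrightarrow> 0 \<le> x $ s \<and> x $ s \<le> c s * W0)}"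

definition wealth :: "('a \<Rightarrow> real ^ 'n) \<Rightarrow> real ^ 'n \<Rightarrow> 'a \<Rightarrow> real" where
  "wealth \<xi> x \<omega> = x \<bullet> (1 + \<xi> \<omega>)"

definition portfolio_model ::
    "'a measure \<Rightarrow> real \<Rightarrow> 'n::finite \<Rightarrow> real \<Rightarrow> ('n \<Rightarrow> real) \<Rightarrow> ('a \<Rightarrow> real ^ 'n) \<Rightarrow> bool" where
  "portfolio_model M b r W0 c \<xi> \<longleftrightarrow>
     W0 \<in> {0..b} \<and> (\<forall>s. s \<noteq> r \<longrightarrow> c s \<in> {0..1}) \<and>
     \<xi> \<in> borel_measurable M \<and> (\<forall>\<omega>\<in>space M. \<xi> \<omega> $ r = 0) \<and>
     (\<forall>x\<in>portfolios r W0 c. \<forall>\<omega>\<in>space M. wealth \<xi> x \<omega> \<in> {0..b})"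

text \<open>The lotteries in the data enter only through their laws, hence probability mass functions.
  All sequences below are indexed from 1, and entries outside the stated ranges are irrelevant.\<close>

definition mle_data ::
    "real \<Rightarrow> nat \<Rightarrow> (nat \<Rightarrow> real pmf) \<Rightarrow> (nat \<Rightarrow> real pmf) \<Rightarrow> (nat \<Rightarrow> real) \<Rightarrow> bool" where
  "mle_data b K W Y Z \<longleftrightarrow>
     (\<forall>k\<in>{1..K}. finite (set_pmf (W k)) \<and> set_pmf (W k) \<subseteq> {0..b} \<and>
                 finite (set_pmf (Y k)) \<and> set_pmf (Y k) \<subseteq> {0..b} \<and> Z k \<in> {1, -1})"

definition grid ::
    "real \<Rightarrow> nat \<Rightarrow> (nat \<Rightarrow> real pmf) \<Rightarrow> (nat \<Rightarrow> real pmf) \<Rightarrow> real set" where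
  "grid b K W Y = {0, b} \<union> (\<Union>k\<in>{1..K}. set_pmf (W k) \<union> set_pmf (Y k))"

definition grid_point ::
    "real \<Rightarrow> nat \<Rightarrow> (nat \<Rightarrow> real pmf) \<Rightarrow> (nat \<Rightarrow> real pmf) \<Rightarrow> nat \<Rightarrow> real" where
  "grid_point b K W Y j = sorted_list_of_set (grid b K W Y) ! (j - 1)"

definition mle_objective ::
    "real \<Rightarrow> nat \<Rightarrow> (nat \<Rightarrow> real pmf) \<Rightarrow> (nat \<Rightarrow> real pmf) \<Rightarrow> (nat \<Rightarrow> real) \<Rightarrow> (nat \<Rightarrow> real) \<Rightarrow> real"
  where
  "mle_objective b K W Y Z \<alpha> =
     (let y = grid_point b K W Y; n = card (grid b K W Y);
          p = (\<lambda>k j. pmf (W k) (y j) - pmf (Y k) (y j))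
      in - (\<Sum>k=1..K. ln (1 + exp (\<Sum>j=1..n. - Z k * p k j * \<alpha> j))))"

definition mle_feasible ::
    "real \<Rightarrow> real \<Rightarrow> real \<Rightarrow> nat \<Rightarrow> (nat \<Rightarrow> real pmf) \<Rightarrow> (nat \<Rightarrow> real pmf) \<Rightarrow>
     (nat \<Rightarrow> real) \<Rightarrow> (nat \<Rightarrow> real) \<Rightarrow> real \<Rightarrow> bool" where
  "mle_feasible b L cmax K W Y \<alpha> \<beta> \<gamma> \<longleftrightarrow>
     (let y = grid_point b K W Y; n = card (grid b K W Y)
      in \<gamma> \<in> {0..cmax} \<and>
         (\<forall>j\<in>{1..<n}. \<beta> j = (\<alpha> (j + 1) - \<alpha> j) / (y (j + 1) - y j)) \<and>
         (\<forall>j\<in>{1..<n - 1}. \<beta> (j + 1) \<le> \<beta> j) \<and>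
         \<beta> 1 \<le> L * \<gamma> \<and> \<beta> (n - 1) \<ge> 0 \<and> \<alpha> 1 = 0 \<and> \<alpha> n = \<gamma>)"

definition mle_solution ::
    "real \<Rightarrow> real \<Rightarrow> real \<Rightarrow> nat \<Rightarrow> (nat \<Rightarrow> real pmf) \<Rightarrow> (nat \<Rightarrow> real pmf) \<Rightarrow> (nat \<Rightarrow> real) \<Rightarrow>
     (nat \<Rightarrow> real) \<Rightarrow> (nat \<Rightarrow> real) \<Rightarrow> real \<Rightarrow> bool" where
  "mle_solution b L cmax K W Y Z \<alpha> \<beta> \<gamma> \<longleftrightarrow>
     is_arg_max (\<lambda>(\<alpha>, \<beta>, \<gamma>). mle_objective b K W Y Z \<alpha>)
                (\<lambda>(\<alpha>, \<beta>, \<gamma>). mle_feasible b L cmax K W Y \<alpha> \<beta> \<gamma>) (\<alpha>, \<beta>, \<gamma>)"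

text \<open>This determines \<open>u\<close> on \<open>[0, b]\<close>, the only place where it is evaluated.\<close>

definition mle_utility ::
    "real \<Rightarrow> nat \<Rightarrow> (nat \<Rightarrow> real pmf) \<Rightarrow> (nat \<Rightarrow> real pmf) \<Rightarrow> (nat \<Rightarrow> real) \<Rightarrow> real \<Rightarrow>
     (real \<Rightarrow> real) \<Rightarrow> bool" where
  "mle_utility b K W Y \<alpha> \<gamma> u \<longleftrightarrow>
     (let y = grid_point b K W Y; n = card (grid b K W Y)
      in continuous_on {0..b} u \<and>
         (\<forall>j\<in>{1..<n}. \<exists>m q. \<forall>t\<in>{y j..y (j + 1)}. u t = m * t + q) \<and>
         (\<forall>j\<in>{1..n}. u (y j) = \<alpha> j / \<gamma>))"

definition optimal_solutions :: "('x \<Rightarrow> real) \<Rightarrow> 'x set \<Rightarrow> 'x set" where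
  "optimal_solutions f A = {x. is_arg_max f (\<lambda>x. x \<in> A) x}"

end

theory Submission
  imports Defs
begin

text \<open>The expected utility a is a constant with respect to the response error. Since the
  Gumbel CDF F is continuous, the constraint P(a + \<epsilon> \<ge> \<eta>) \<ge> 1 - \<delta> reads
  F(\<eta> - a) \<le> \<delta>. As F is strictly increasing and attains \<delta>, this means that
  \<eta> is at most a plus the \<delta>-quantile, and the largest such \<eta> is that bound itself
  (\<open>gumbel_prob_ge\<close>, \<open>pref_at_risk_gumbel\<close>). Hence the two portfolio
  objectives differ by a number independent of x, which leaves the maximizers unchanged
  (\<open>optimal_solutions_add_const\<close>).\<close>

lemma gumbel_cdf_strict_mono:
  assumes "\<sigma> > 0"
  shows "strict_mono (gumbel_cdf \<sigma>)"
  using assms by (intro strict_monoI) (simp add: gumbel_cdf_def divide_strict_right_mono)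

text \<open>\<open>inv\<close> is a choice inverse, meaningful only on the range of the CDF, so the
  point is that this range contains (0,1).\<close>

lemma gumbel_cdf_inv:
  assumes "\<sigma> > 0" and "\<delta> \<in> {0<..<1}"
  shows "gumbel_cdf \<sigma> (inv (gumbel_cdf \<sigma>) \<delta>) = \<delta>"
proof (rule f_inv_into_f)
  \<comment> \<open>The witness solves exp (- exp (- x / \<sigma>)) = \<delta> for x; the outer
    logarithm is legitimate because - ln \<delta> > 0.\<close>
  have "gumbel_cdf \<sigma> (- \<sigma> * ln (- ln \<delta>)) = \<delta>"
    using assms by (simp add: gumbel_cdf_def)
  then show "\<delta> \<in> range (gumbel_cdf \<sigma>)"
    by (metis rangeI)
qed

text \<open>The complement of {..t} is the open half-line, whereas the event is closed. The two
  differ by the atom at t, which has mass 0 because the CDF is continuous there.\<close>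

lemma gumbel_prob_ge:
  assumes "prob_space N" and "\<sigma> > 0" and "gumbel_distributed N \<sigma> \<epsilon>"
  shows "measure N {e \<in> space N. \<epsilon> e \<ge> t} = 1 - gumbel_cdf \<sigma> t"
proof -
  have [measurable]: "\<epsilon> \<in> borel_measurable N"
    and cdf: "cdf (distr N borel \<epsilon>) = gumbel_cdf \<sigma>"
    using assms(3) by (auto simp: gumbel_distributed_def)
  interpret D: prob_space "distr N borel \<epsilon>"
    using assms(1) by (simp add: prob_space.prob_space_distr)
  interpret D: finite_borel_measure "distr N borel \<epsilon>"
    by unfold_locales simp
  have "isCont (gumbel_cdf \<sigma>) t"
    using assms(2) unfolding gumbel_cdf_def by (intro continuous_intros) auto
  then have atom: "measure (distr N borel \<epsilon>) {t} = 0"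
    using D.isCont_cdf[of t] cdf by simp
  have "measure N {e \<in> space N. \<epsilon> e \<ge> t} = measure (distr N borel \<epsilon>) {t..}"
    by (subst measure_distr) (auto intro!: arg_cong[where f = "measure N"])
  also have "{t..} = {t} \<union> (- {..t})"
    by auto
  also have "measure (distr N borel \<epsilon>) \<dots> =
      measure (distr N borel \<epsilon>) {t} + measure (distr N borel \<epsilon>) (- {..t})"
    by (rule D.finite_measure_Union) auto
  also have "\<dots> = 1 - gumbel_cdf \<sigma> t"
    using D.prob_compl[of "{..t}"] atom cdf by (simp add: Compl_eq_Diff_UNIV cdf_def fun_eq_iff)
  finally show ?thesis .
qed

lemma pref_at_risk_gumbel:
  assumes "prob_space N" and "\<sigma> > 0" and "gumbel_distributed N \<sigma> \<epsilon>" and "\<delta> \<in> {0<..<1}"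
  shows "pref_at_risk M N \<epsilon> u \<delta> X = (\<integral>\<omega>. u (X \<omega>) \<partial>M) + inv (gumbel_cdf \<sigma>) \<delta>"
proof -
  \<comment> \<open>Only the value of this integral matters below: should it take the default 0 of a
    non-integrable function, it does so on both sides.\<close>
  define a where "a = (\<integral>\<omega>. u (X \<omega>) \<partial>M)"
  define q where "q = inv (gumbel_cdf \<sigma>) \<delta>"
  have "measure N {e \<in> space N. a + \<epsilon> e \<ge> \<eta>} \<ge> 1 - \<delta> \<longleftrightarrow> \<eta> \<le> a + q" for \<eta>
  proof -
    have "measure N {e \<in> space N. a + \<epsilon> e \<ge> \<eta>} = 1 - gumbel_cdf \<sigma> (\<eta> - a)"
      using gumbel_prob_ge[OF assms(1-3), of "\<eta> - a"] by (simp add: algebra_simps)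
    moreover have "gumbel_cdf \<sigma> (\<eta> - a) \<le> gumbel_cdf \<sigma> q \<longleftrightarrow> \<eta> - a \<le> q"
      using gumbel_cdf_strict_mono[OF assms(2)] by (rule strict_mono_less_eq)
    ultimately show ?thesis
      using gumbel_cdf_inv[OF assms(2,4)] by (auto simp: q_def)
  qed
  then have "pref_at_risk M N \<epsilon> u \<delta> X = (GREATEST \<eta>. \<eta> \<le> a + q)"
    by (simp add: pref_at_risk_def flip: a_def)
  \<comment> \<open>The admissible levels form a closed half-line, so its endpoint is an attained
    maximum, as \<open>GREATEST\<close> requires.\<close>
  also have "\<dots> = a + q"
    by (rule Greatest_equality) auto
  finally show ?thesis
    by (simp add: a_def q_def)
qed

lemma optimal_solutions_add_const:
  fixes f :: "'x \<Rightarrow> real"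
  shows "optimal_solutions (\<lambda>x. f x + k) A = optimal_solutions f A"
  by (simp add: optimal_solutions_def is_arg_max_def)

theorem proposition6:
  fixes M :: "'a measure" and N :: "'e measure" and \<epsilon> :: "'e \<Rightarrow> real"
    and b L cmax \<sigma> p :: real
  assumes "prob_space M" and "prob_space N"
    and "b > 0" and "L > 0" and "cmax > 0" and "\<sigma> > 0" and "p > 0"
    and "gumbel_distributed N \<sigma> \<epsilon>"
  shows
    "(\<forall>\<delta>\<in>{0<..<1}. \<forall>u\<in>utilities b. \<forall>X\<in>Lp_interval M p b.
        pref_at_risk M N \<epsilon> u \<delta> X = (\<integral>\<omega>. u (X \<omega>) \<partial>M) + inv (gumbel_cdf \<sigma>) \<delta>) \<and>
     (\<forall>\<delta>\<in>{0<..<1}. \<forall>(r :: 'n::finite) W0 c \<xi> K W Y Z \<alpha> \<beta> \<gamma> u_mle.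
        portfolio_model M b r W0 c \<xi> \<longrightarrow>
        mle_data b K W Y Z \<longrightarrow>
        mle_solution b L cmax K W Y Z \<alpha> \<beta> \<gamma> \<longrightarrow>
        \<gamma> > 0 \<longrightarrow>
        mle_utility b K W Y \<alpha> \<gamma> u_mle \<longrightarrow>
        optimal_solutions (\<lambda>x. pref_at_risk M N \<epsilon> u_mle \<delta> (wealth \<xi> x)) (portfolios r W0 c)
        = optimal_solutions (\<lambda>x. \<integral>\<omega>. u_mle (wealth \<xi> x \<omega>) \<partial>M) (portfolios r W0 c))"
  \<comment> \<open>In the second part the quantile is the constant k of
    \<open>optimal_solutions_add_const\<close>, as it does not involve x.\<close>
  by (auto simp: pref_at_risk_gumbel[OF assms(2,6,8)] optimal_solutions_add_const)

end
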